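(* Let $A,B,C,D\in\widehat{\mathbb{F}_q^{*}}$. Then $$ {}_{4}F_3\!\left(\begin{array}{cccc} A, & B, & C, & D\\ & A\bar{B}, & A\bar{C}, & A\bar{D}\end{array}\Big|\;-1\right)_q^{\star}=0\quad\text{if } A \text{ is not a square}, $$ and if $A$ is a square with $A\neq\varepsilon$, $B\neq\varepsilon$ and $B^2\neq A$, then $$ {}_{4}F_3\!\left(\begin{array}{cccc} A, & B, & C, & D\\ & A\bar{B}, & A\bar{C}, & A\bar{D}\end{array}\Big|\;-1\right)_q^{\star} =\frac{g(\bar{A})\,g(\bar{A}CD)}{g(\bar{A}C)\,g(\bar{A}D)}\sum_{R^2=A}{}_{3}F_2\!\left(\begin{array}{ccc} R\bar{B}, & C, & D\\ & R, & A\bar{B}\end{array}\Big|\;1\right)_q^{\star} +\frac{q(q-1)\,\delta(\bar{A}CD)}{g(C)\,g(\bar{C})\,g(A\bar{C})\,g(\bar{A}C)}\;{}_{2}F_1\!\left(\begin{array}{cc} A, & B\\ & A\bar{B}\end{array}\Big|\;-1\right)_q^{\star}. $$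
   Context: Let $q$ be a prime power and $\mathbb{F}_q$ the finite field with $q$ elements. $\widehat{\mathbb{F}_q^{*}}$ denotes the group of multiplicative characters of $\mathbb{F}_q^{*}$; every character $\chi$ (including the trivial character $\varepsilon$) is extended to $\mathbb{F}_q$ by $\chi(0):=0$. $\bar{\chi}$ denotes the inverse character, and juxtaposition denotes pointwise product of characters. Fix a non-trivial additive character $\theta$ of $\mathbb{F}_q$ and define the Gauss sum $g(\chi):=\sum_{x\in\mathbb{F}_q}\chi(x)\theta(x)$. For $A_0,\dots,A_n,B_1,\dots,B_n\in\widehat{\mathbb{F}_q^{*}}$ and $x\in\mathbb{F}_q$ define $$ {}_{n+1}F_n\!\left(\begin{array}{cccc} A_0, & A_1, & \dots, & A_n\\ & B_1, & \dots, & B_n\end{array}\Big|\;x\right)_q^{\star}:=\frac{1}{q-1}\sum_{\chi\in\widehat{\mathbb{F}_q^{*}}}\prod_{i=0}^{n}\frac{g(A_i\chi)}{g(A_i)}\prod_{j=1}^{n}\frac{g(\overline{B_j\chi})}{g(\overline{B_j})}\,g(\bar{\chi})\,\chi(-1)^{n+1}\chi(x). $$ $\delta(\chi)=1$ if $\chi=\varepsilon$ and $0$ otherwise. "$A$ is a square" means $A=S^2$ for some character $S$; $\sum_{R^2=A}$ denotes the sum over all characters $R$ with $R^2=A$.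
   Formalization: The second identity (A a square) is stated only for odd q, since it fails for even q: for q = 4 with A = B of order 3 and C = D = ε, the left side is −6 and the right side is 5; the vanishing for non-square A is stated for every q. *)

theory Defs
  imports Complex_Main "HOL-Library.Cardinality"
begin

text \<open>
  The finite field \<open>F\<^sub>q\<close> is a type \<open>'a :: {field, finite}\<close>, with \<open>q = CARD('a)\<close>. A multiplicative
  character is represented by its extension by zero to the whole field, so \<open>\<chi> 0 = 0\<close> also holds
  for the trivial character.
\<close>

definition mult_chars :: "('a::{field,finite} \<Rightarrow> complex) set" where
  "mult_chars = {\<chi>. \<chi> 0 = 0 \<and> (\<forall>x. x \<noteq> 0 \<longrightarrow> \<chi> x \<noteq> 0) \<and> (\<forall>x y. \<chi> (x * y) = \<chi> x * \<chi> y)}"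

definition triv_char :: "'a::{field,finite} \<Rightarrow> complex" where
  "triv_char x = (if x = 0 then 0 else 1)"

definition char_mult :: "('a::{field,finite} \<Rightarrow> complex) \<Rightarrow> ('a \<Rightarrow> complex) \<Rightarrow> 'a \<Rightarrow> complex"
    (infixl "\<odot>" 70) where
  "(\<chi> \<odot> \<psi>) x = \<chi> x * \<psi> x"

text \<open>At \<open>0\<close> this uses \<open>inverse 0 = 0\<close>.\<close>

definition char_inv :: "('a::{field,finite} \<Rightarrow> complex) \<Rightarrow> 'a \<Rightarrow> complex" where
  "char_inv \<chi> x = inverse (\<chi> x)"

definition is_square_char :: "('a::{field,finite} \<Rightarrow> complex) \<Rightarrow> bool" where
  "is_square_char \<chi> \<longleftrightarrow> (\<exists>S\<in>mult_chars. \<chi> = S \<odot> S)"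

definition char_delta :: "('a::{field,finite} \<Rightarrow> complex) \<Rightarrow> complex" where
  "char_delta \<chi> = (if \<chi> = triv_char then 1 else 0)"

definition nontriv_add_char :: "('a::{field,finite} \<Rightarrow> complex) \<Rightarrow> bool" where
  "nontriv_add_char \<theta> \<longleftrightarrow>
     (\<forall>x. \<theta> x \<noteq> 0) \<and> (\<forall>x y. \<theta> (x + y) = \<theta> x * \<theta> y) \<and> (\<exists>x. \<theta> x \<noteq> 1)"

definition gauss_sum :: "('a::{field,finite} \<Rightarrow> complex) \<Rightarrow> ('a \<Rightarrow> complex) \<Rightarrow> complex" where
  "gauss_sum \<theta> \<chi> = (\<Sum>x\<in>UNIV. \<chi> x * \<theta> x)"

text \<open>
  \<open>hyp_F \<theta> [A\<^sub>0, \<dots>, A\<^sub>n] [B\<^sub>1, \<dots>, B\<^sub>n] x\<close>; intended for \<open>length As = length Bs + 1\<close>.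
\<close>

definition hyp_F ::
  "('a::{field,finite} \<Rightarrow> complex) \<Rightarrow> ('a \<Rightarrow> complex) list \<Rightarrow> ('a \<Rightarrow> complex) list \<Rightarrow> 'a \<Rightarrow> complex"
where
  "hyp_F \<theta> As Bs x =
     1 / (of_nat CARD('a) - 1) *
     (\<Sum>\<chi>\<in>mult_chars.
        (\<Prod>A\<leftarrow>As. gauss_sum \<theta> (A \<odot> \<chi>) / gauss_sum \<theta> A) *
        (\<Prod>B\<leftarrow>Bs. gauss_sum \<theta> (char_inv (B \<odot> \<chi>)) / gauss_sum \<theta> (char_inv B)) *
        gauss_sum \<theta> (char_inv \<chi>) * \<chi> (- 1) ^ (length Bs + 1) * \<chi> x)"

end

theory Submission
  imports Defs "HOL-Algebra.Multiplicative_Group"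
begin

text \<open>
  Write \<open>M = \<Sum>\<chi> g(A\<chi>) g(\<chi>\<^sup>-\<^sup>1) \<Prod>\<^sub>X g(X\<chi>) g(A\<^sup>-\<^sup>1X\<chi>\<^sup>-\<^sup>1) \<chi>(-1)\<close>, with \<open>X\<close> running over \<open>B, C, D\<close>; up to
  normalisation this is the \<open>4F3\<close>. The substitution \<open>\<chi> \<mapsto> (A\<chi>)\<^sup>-\<^sup>1\<close> shows \<open>M = A(-1) M\<close>, and
  \<open>A(-1) = -1\<close> when \<open>A\<close> is not a square.

  For square \<open>A\<close>, the finite field version of Barnes' first lemma rewrites the four Gauss sums
  involving \<open>C\<close> and \<open>D\<close> as a sum over an auxiliary character \<open>\<psi>\<close>; its degenerate term produces
  the \<open>2F1\<close>. The inner sum over \<open>\<chi>\<close> is then a well-poised \<open>3F2\<close> at \<open>1\<close> with parameters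
  \<open>A, B, \<psi>\<^sup>-\<^sup>1\<close>, and Dixon's theorem evaluates it as a sum over \<open>R\<^sup>2 = A\<close>. Dixon's theorem in turn
  follows by applying Barnes' lemma to a pair of parameters, evaluating the resulting well-poised
  \<open>2F1\<close> at \<open>-1\<close> by Kummer's theorem, and applying Barnes' lemma once more. Kummer's theorem reduces
  to \<open>\<Sum>r A(r) B\<^sup>-\<^sup>1(1 - r\<^sup>2)\<close> and the identity \<open>\<Sum>\<^bsub>u\<^sup>2 = v\<^esub> A(u) = \<Sum>\<^bsub>R\<^sup>2 = A\<^esub> R(v)\<close>.
\<close>

no_notation Module.smult (infixl "\<odot>\<index>" 70)

section \<open>The group of multiplicative characters\<close>

lemma mult_charsD:
  assumes "\<chi> \<in> mult_chars"
  shows "\<chi> 0 = 0" "x \<noteq> 0 \<Longrightarrow> \<chi> x \<noteq> 0" "\<chi> (x * y) = \<chi> x * \<chi> y"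
  using assms by (auto simp: mult_chars_def)

lemma triv_char_in_mult_chars: "triv_char \<in> mult_chars"
  by (auto simp: mult_chars_def triv_char_def)

lemma char_mult_in_mult_chars:
  "\<chi> \<in> mult_chars \<Longrightarrow> \<psi> \<in> mult_chars \<Longrightarrow> \<chi> \<odot> \<psi> \<in> mult_chars"
  by (auto simp: mult_chars_def char_mult_def)

lemma char_inv_in_mult_chars: "\<chi> \<in> mult_chars \<Longrightarrow> char_inv \<chi> \<in> mult_chars"
  by (auto simp: mult_chars_def char_inv_def)

text \<open>
  Characters are collected in a type whose group operation is written additively, so that the
  simplifier's normalisation for \<open>ab_group_add\<close> decides identities between products of characters.
\<close>

typedef (overloaded) 'a mchar = "mult_chars :: ('a::{field,finite} \<Rightarrow> complex) set"
  morphisms ev Abs_mchar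
  using triv_char_in_mult_chars by blast

instantiation mchar :: ("{field,finite}") ab_group_add
begin

definition "0 = Abs_mchar triv_char"
definition "\<chi> + \<psi> = Abs_mchar (ev \<chi> \<odot> ev \<psi>)"
definition "- \<chi> = Abs_mchar (char_inv (ev \<chi>))"
definition "\<chi> - \<psi> = Abs_mchar (ev \<chi> \<odot> char_inv (ev \<psi>))"

instance
proof
  fix a b c :: "'a mchar"
  note defs = zero_mchar_def plus_mchar_def uminus_mchar_def minus_mchar_def
    Abs_mchar_inverse ev triv_char_in_mult_chars char_mult_in_mult_chars char_inv_in_mult_chars
  show "a + b + c = a + (b + c)"
    by (simp add: defs ev_inject[symmetric] char_mult_def fun_eq_iff)
  show "a + b = b + a"
    by (simp add: defs ev_inject[symmetric] char_mult_def fun_eq_iff)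
  show "0 + a = a"
    using mult_charsD(1)[OF ev[of a]]
    by (simp add: defs ev_inject[symmetric] char_mult_def triv_char_def fun_eq_iff)
  show "- a + a = 0"
    using mult_charsD(1,2)[OF ev[of a]]
    by (simp add: defs ev_inject[symmetric] char_mult_def char_inv_def triv_char_def fun_eq_iff)
  show "a - b = a + - b"
    by (simp add: defs)
qed

end

lemma ev_zero_char: "ev (0::'a::{field,finite} mchar) = triv_char"
  by (simp add: zero_mchar_def Abs_mchar_inverse triv_char_in_mult_chars)

lemma ev_plus_char: "ev (\<chi> + \<psi>) = ev \<chi> \<odot> ev \<psi>"
  by (simp add: plus_mchar_def Abs_mchar_inverse char_mult_in_mult_chars ev)

lemma ev_uminus_char: "ev (- \<chi>) = char_inv (ev \<chi>)"
  by (simp add: uminus_mchar_def Abs_mchar_inverse char_inv_in_mult_chars ev)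

lemma ev_0 [simp]: "ev 0 x = (if x = 0 then 0 else 1)"
  by (simp add: ev_zero_char triv_char_def)

lemma ev_plus [simp]: "ev (\<chi> + \<psi>) x = ev \<chi> x * ev \<psi> x"
  by (simp add: ev_plus_char char_mult_def)

lemma ev_uminus [simp]: "ev (- \<chi>) x = inverse (ev \<chi> x)"
  by (simp add: ev_uminus_char char_inv_def)

lemma ev_minus [simp]: "ev (\<chi> - \<psi>) x = ev \<chi> x / ev \<psi> x"
  unfolding diff_conv_add_uminus[of \<chi>] by (simp only: ev_plus ev_uminus divide_inverse)

lemma ev_at_0 [simp]: "ev \<chi> 0 = 0"
  using mult_charsD(1)[OF ev] .

lemma ev_mult: "ev \<chi> (x * y) = ev \<chi> x * ev \<chi> y"
  using mult_charsD(3)[OF ev] .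

lemma ev_eq_0_iff [simp]: "ev \<chi> x = 0 \<longleftrightarrow> x = 0"
  using mult_charsD(2)[OF ev] by auto

lemma ev_1 [simp]: "ev \<chi> 1 = 1"
  using ev_mult[of \<chi> 1 1] by simp

lemma ev_inverse: "ev \<chi> (inverse x) = inverse (ev \<chi> x)"
proof (cases "x = 0")
  case False
  hence "ev \<chi> (inverse x) * ev \<chi> x = 1"
    by (simp flip: ev_mult)
  with False show ?thesis
    by (simp add: field_simps)
qed simp

lemma ev_divide: "ev \<chi> (x / y) = ev \<chi> x / ev \<chi> y"
  by (simp add: divide_inverse ev_mult ev_inverse)

lemma ev_neg1_square [simp]: "ev \<chi> (-1) * ev \<chi> (-1) = 1"
  by (simp flip: ev_mult)

lemma ev_neg1_square_left [simp]: "ev \<chi> (-1) * (ev \<chi> (-1) * z) = z"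
  by (simp flip: mult.assoc)

lemma inverse_ev_neg1 [simp]: "inverse (ev \<chi> (-1)) = ev \<chi> (-1)"
  by (rule inverse_unique) simp

lemma divide_ev_neg1 [simp]: "z / ev \<chi> (-1) = z * ev \<chi> (-1)"
  by (simp add: divide_inverse)

lemma ev_neg: "ev \<chi> (- x) = ev \<chi> (-1) * ev \<chi> x"
  by (simp flip: ev_mult)

lemma mchar_eqI: "(\<And>x. x \<noteq> 0 \<Longrightarrow> ev \<chi> x = ev \<psi> x) \<Longrightarrow> \<chi> = \<psi>"
  by (metis ev_at_0 ev_inject ext)

section \<open>Finiteness of the character group and separation of points\<close>

text \<open>Multiplication by \<open>x\<close> permutes the nonzero elements, so their product
  absorbs one factor \<open>x\<close> for each of them.\<close>

lemma finite_field_power_card: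
  fixes x :: "'a::{field,finite}"
  assumes "x \<noteq> 0"
  shows "x ^ (CARD('a) - 1) = 1"
proof -
  have "(\<Prod>y\<in>UNIV-{0}. y) = (\<Prod>y\<in>UNIV-{0}. x * y)"
    by (rule prod.reindex_bij_witness[of _ "\<lambda>y. x * y" "\<lambda>y. y / x"]) (use assms in auto)
  also have "\<dots> = x ^ (CARD('a) - 1) * (\<Prod>y\<in>UNIV-{0}. y)"
    by (simp add: prod.distrib)
  finally show ?thesis
    by (simp add: prod_zero_iff)
qed

text \<open>Away from \<open>0\<close> every character value is a root of unity of order dividing
  \<open>CARD('a) - 1\<close>, which leaves finitely many functions. Sums over all characters depend
  on this.\<close>

instance mchar :: ("{field,finite}") finite
proof
  let ?n = "CARD('a) - 1"
  have "CARD('a) \<ge> 2"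
    using card_mono[of "UNIV :: 'a set" "{0,1}"] by simp
  then have "finite {z::complex. z ^ ?n = 1}"
    by (intro finite_roots_unity) simp
  then have "finite (UNIV \<rightarrow>\<^sub>E insert 0 {z. z ^ ?n = 1} :: ('a \<Rightarrow> complex) set)"
    by (intro finite_PiE) auto
  moreover have "range (ev :: 'a mchar \<Rightarrow> _) \<subseteq> (UNIV \<rightarrow>\<^sub>E insert 0 {z. z ^ ?n = 1})"
  proof -
    have "ev \<chi> x ^ ?n = 1" if "x \<noteq> 0" for \<chi> :: "'a mchar" and x
    proof -
      have "ev \<chi> (x ^ k) = ev \<chi> x ^ k" for k
        by (induction k) (simp_all add: ev_mult)
      then show ?thesis
        using finite_field_power_card[OF that] by (metis ev_1)
    qed
    then show ?thesis
      by (auto simp: PiE_UNIV_domain)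
  qed
  ultimately show "finite (UNIV :: 'a mchar set)"
    by (metis finite_imageD finite_subset injI ev_inject)
qed

lemma finite_field_generator:
  obtains \<gamma> :: "'a::{field,finite}" where "\<gamma> \<noteq> 0" "\<And>x. x \<noteq> 0 \<Longrightarrow> \<exists>i::nat. x = \<gamma> ^ i"
proof -
  \<comment> \<open>The theorem that the unit group is cyclic speaks about ring records, so the
    field type is packaged as one.\<close>
  define R :: "'a ring" where
    "R = \<lparr>carrier = UNIV, monoid.mult = (*), one = 1, ring.zero = 0, add = (+)\<rparr>"
  have "\<exists>y. x + y = 0" for x :: 'a
    using add.right_inverse by blast
  moreover have "x \<noteq> 0 \<Longrightarrow> \<exists>y. x * y = 1" for x :: 'a
    by (rule exI[of _ "inverse x"]) auto
  ultimately interpret R: field R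
    unfolding R_def using add.right_inverse
    by unfold_locales (auto simp: algebra_simps Units_def)
  have pow: "x [^]\<^bsub>R\<^esub> (i::nat) = x ^ i" for x i
    by (induction i) (simp_all add: nat_pow_def R_def)
  have "finite (carrier R)"
    by (simp add: R_def)
  from R.finite_field_mult_group_has_gen[OF this] obtain \<gamma>
    where "\<gamma> \<in> carrier (mult_of R)" "carrier (mult_of R) = {\<gamma> ^ i | i::nat. i \<in> UNIV}"
    unfolding pow by (elim bexE)
  moreover have "carrier (mult_of R) = UNIV - {0}"
    by (simp add: R_def)
  ultimately show ?thesis
    by (intro that[of \<gamma>]) auto
qed

text \<open>Sending a generator to a primitive root of unity of order \<open>CARD('a) - 1\<close>
  gives a faithful character, and this single character separates every such \<open>x\<close> from
  \<open>1\<close>.\<close>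

lemma mchar_separates_points:
  fixes x :: "'a::{field,finite}"
  assumes "x \<noteq> 0" "x \<noteq> 1"
  obtains \<chi> where "ev \<chi> x \<noteq> 1"
proof -
  obtain \<gamma> :: 'a where "\<gamma> \<noteq> 0" and gen: "\<And>x. x \<noteq> 0 \<Longrightarrow> \<exists>i::nat. x = \<gamma> ^ i"
    using finite_field_generator by blast
  define n where "n = CARD('a) - 1"
  have "n > 0"
    using card_mono[of "UNIV :: 'a set" "{0,1}"] by (simp add: n_def)
  have "\<gamma> ^ n = 1"
    using finite_field_power_card[OF \<open>\<gamma> \<noteq> 0\<close>] by (simp add: n_def)
  \<comment> \<open>Polymorphic, since it serves both \<open>\<gamma>\<close> in the field and
    \<open>\<zeta>\<close> in the complex numbers.\<close>
  have power_mod: "z ^ (k mod n) = z ^ k" if "z ^ n = 1" for z :: "'b::monoid_mult" and k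
    by (metis mult_1 mult_div_mod_eq power_add power_mult power_one that)
  have "(\<lambda>i. \<gamma> ^ i) ` {..<n} = UNIV - {0}"
  proof (intro equalityI subsetI)
    fix y :: 'a assume "y \<in> UNIV - {0}"
    then obtain i where "y = \<gamma> ^ i"
      using gen by auto
    then have "y = \<gamma> ^ (i mod n)"
      by (simp add: power_mod[OF \<open>\<gamma> ^ n = 1\<close>])
    then show "y \<in> (\<lambda>i. \<gamma> ^ i) ` {..<n}"
      using \<open>n > 0\<close> by auto
  qed (use \<open>\<gamma> \<noteq> 0\<close> in auto)
  \<comment> \<open>There are exactly \<open>n\<close> nonzero elements, so surjectivity already
    forces injectivity.\<close>
  then have bij: "bij_betw (\<lambda>i. \<gamma> ^ i) {..<n} (UNIV - {0})"
    by (auto simp: bij_betw_def n_def intro: eq_card_imp_inj_on)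
  \<comment> \<open>The discrete logarithm to base \<open>\<gamma>\<close>.\<close>
  define ind where "ind = the_inv_into {..<n} (\<lambda>i. \<gamma> ^ i)"
  have ind: "ind y < n" "\<gamma> ^ ind y = y" if "y \<noteq> 0" for y
    using that bij f_the_inv_into_f_bij_betw[OF bij, of y] bij_betw_the_inv_into[OF bij]
    by (auto simp: ind_def bij_betw_def)
  have ind_eqI: "ind y = i mod n" if "y = \<gamma> ^ i" for y i
  proof -
    have "y \<noteq> 0"
      using that \<open>\<gamma> \<noteq> 0\<close> by simp
    moreover have "\<gamma> ^ (i mod n) = y"
      by (simp add: that power_mod[OF \<open>\<gamma> ^ n = 1\<close>])
    ultimately show ?thesis
      using ind[of y] bij \<open>n > 0\<close> by (auto simp: bij_betw_def inj_on_def)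
  qed
  define \<zeta> where "\<zeta> = cis (2 * pi / real n)"
  have \<zeta>_pow: "\<zeta> ^ k = cis (2 * pi * real k / real n)" for k
    by (simp add: \<zeta>_def DeMoivre mult_ac)
  have "\<zeta> ^ n = 1"
    using \<open>n > 0\<close> by (simp add: \<zeta>_pow)
  define \<chi> where "\<chi> y = (if y = 0 then 0 else \<zeta> ^ ind y)" for y
  have "\<chi> (y * z) = \<chi> y * \<chi> z" for y z
  proof (cases "y = 0 \<or> z = 0")
    case False
    then have "y * z = \<gamma> ^ (ind y + ind z)"
      using ind(2)[of y] ind(2)[of z] by (simp add: power_add)
    then have "\<zeta> ^ ind (y * z) = \<zeta> ^ (ind y + ind z)"
      by (simp add: ind_eqI power_mod[OF \<open>\<zeta> ^ n = 1\<close>])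
    with False show ?thesis
      by (simp add: \<chi>_def power_add)
  qed (auto simp: \<chi>_def)
  then have "\<chi> \<in> mult_chars"
    by (auto simp: mult_chars_def \<chi>_def \<zeta>_def)
  moreover have "\<chi> x \<noteq> 1"
  proof
    assume "\<chi> x = 1"
    then have "\<zeta> ^ ind x = \<zeta> ^ 0"
      using assms by (simp add: \<chi>_def)
    moreover have "inj_on (\<lambda>k. \<zeta> ^ k) {..<n}"
      using bij_betw_roots_unity[OF \<open>n > 0\<close>] by (simp add: \<zeta>_pow bij_betw_def)
    ultimately have "ind x = 0"
      using ind(1)[OF assms(1)] \<open>n > 0\<close> by (auto simp: inj_on_def)
    with ind(2)[OF assms(1)] assms(2) show False
      by simp
  qed
  ultimately show ?thesis
    using that[of "Abs_mchar \<chi>"] by (simp add: Abs_mchar_inverse)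
qed

section \<open>Orthogonality relations and square roots\<close>

lemma sum_mchar_shift: "(\<Sum>\<chi>\<in>UNIV. f (\<psi> + \<chi>)) = (\<Sum>\<chi>\<in>UNIV. f (\<chi> :: 'a::{field,finite} mchar))"
  by (rule sum.reindex_bij_witness[of _ "\<lambda>\<chi>. \<chi> - \<psi>" "\<lambda>\<chi>. \<psi> + \<chi>"]) auto

lemma sum_mchar_reflect: "(\<Sum>\<chi>\<in>UNIV. f (- \<psi> - \<chi>)) = (\<Sum>\<chi>\<in>UNIV. f (\<chi> :: 'a::{field,finite} mchar))"
  by (rule sum.reindex_bij_witness[of _ "\<lambda>\<chi>. - \<psi> - \<chi>" "\<lambda>\<chi>. - \<psi> - \<chi>"]) auto

lemma sum_field_scale:
  assumes "c \<noteq> (0::'a::{field,finite})"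
  shows "(\<Sum>x\<in>UNIV. f (c * x)) = (\<Sum>x\<in>UNIV. f x)"
  by (rule sum.reindex_bij_witness[of _ "\<lambda>x. x / c" "\<lambda>x. c * x"]) (use assms in auto)

lemma sum_ev:
  "(\<Sum>x\<in>UNIV. ev (\<chi> :: 'a::{field,finite} mchar) x) = (if \<chi> = 0 then of_nat CARD('a) - 1 else 0)"
proof (cases "\<chi> = 0")
  case True
  have "(\<Sum>x\<in>UNIV. if x = (0::'a) then 0 else 1::complex) = (\<Sum>x\<in>UNIV - {0::'a}. 1)"
    by (rule sum.mono_neutral_cong_right) auto
  moreover have "CARD('a) \<ge> 1"
    by (simp add: Suc_leI)
  ultimately show ?thesis
    using True by (simp add: of_nat_diff)
next
  case False
  then obtain y where "y \<noteq> 0" "ev \<chi> y \<noteq> 1"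
    using mchar_eqI[of \<chi> 0] by auto
  moreover have "(\<Sum>x\<in>UNIV. ev \<chi> x) = ev \<chi> y * (\<Sum>x\<in>UNIV. ev \<chi> x)"
    using sum_field_scale[OF \<open>y \<noteq> 0\<close>, of "ev \<chi>"] by (simp add: ev_mult sum_distrib_left)
  ultimately show ?thesis
    using False by simp
qed

lemma sum_mchars:
  fixes x :: "'a::{field,finite}"
  shows "(\<Sum>\<chi>\<in>UNIV. ev \<chi> x) = (if x = 1 then of_nat CARD('a) - 1 else 0)"
proof -
  have zero: "(\<Sum>\<chi>\<in>UNIV. ev \<chi> x) = 0" if x: "x \<noteq> 1" for x :: 'a
  proof (cases "x = 0")
    case False
    then obtain \<psi> where "ev \<psi> x \<noteq> 1"
      using mchar_separates_points[of x] x by blast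
    moreover have "(\<Sum>\<chi>\<in>UNIV. ev \<chi> x) = ev \<psi> x * (\<Sum>\<chi>\<in>UNIV. ev \<chi> x)"
      using sum_mchar_shift[of "\<lambda>\<chi>. ev \<chi> x" \<psi>] by (simp add: sum_distrib_left)
    ultimately show ?thesis
      by simp
  qed simp
  \<comment> \<open>At \<open>1\<close> the sum counts the characters. As it vanishes at all other
    points, the count equals a double sum, and summing over the field first leaves only the trivial
    character.\<close>
  have "(\<Sum>\<chi>\<in>UNIV. ev \<chi> (1::'a)) = (\<Sum>x\<in>UNIV. \<Sum>\<chi>\<in>UNIV. ev \<chi> (x::'a))"
    by (simp add: zero sum.remove[of UNIV "1::'a"])
  also have "\<dots> = (\<Sum>\<chi>\<in>UNIV. \<Sum>x\<in>UNIV. ev \<chi> (x::'a))"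
    by (rule sum.swap)
  also have "\<dots> = of_nat CARD('a) - 1"
    by (simp add: sum_ev)
  finally show ?thesis
    using zero by auto
qed

text \<open>Detecting \<open>R\<^sup>2 = A\<close> and \<open>u\<^sup>2 = v\<close> by the two orthogonality relations.\<close>

lemma sum_square_roots:
  fixes A :: "'a::{field,finite} mchar"
  shows "(\<Sum>R | R + R = A. ev R v) = (\<Sum>u | u * u = v. ev A u)"
proof (cases "v = 0")
  case True
  then show ?thesis
    by (simp cong: conj_cong)
next
  case False
  let ?N = "of_nat CARD('a) - 1 :: complex"
  have "CARD('a) \<ge> 2"
    using card_mono[of "UNIV :: 'a set" "{0,1}"] by simp
  then have "?N \<noteq> 0"
    by (simp add: of_nat_eq_1_iff)
  have "?N * (\<Sum>R | R + R = A. ev R v) = (\<Sum>R\<in>UNIV. ev R v * (\<Sum>u\<in>UNIV. ev (A - (R + R)) u))"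
    unfolding sum_ev by (simp add: sum_distrib_left if_distrib sum.If_cases eq_commute[of A] mult.commute
          cong: if_cong)
  also have "\<dots> = (\<Sum>u\<in>UNIV. \<Sum>R\<in>UNIV. ev A u * ev R (v / (u * u)))"
    by (subst sum.swap) (simp add: sum_distrib_left ev_divide ev_mult mult_ac)
  also have "\<dots> = (\<Sum>u\<in>UNIV. ev A u * (\<Sum>R\<in>UNIV. ev R (v / (u * u))))"
    by (simp only: sum_distrib_left)
  also have "\<dots> = ?N * (\<Sum>u | v / (u * u) = 1. ev A u)"
    unfolding sum_mchars
    by (simp add: sum_distrib_left if_distrib sum.If_cases mult.commute cong: if_cong)
  also have "{u. v / (u * u) = 1} = {u. u * u = v}"
    using False by (auto simp: divide_eq_1_iff)
  finally show ?thesis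
    using \<open>?N \<noteq> 0\<close> by simp
qed

section \<open>Gauss sums\<close>

locale gauss_sums =
  fixes \<theta> :: "'a::{field,finite} \<Rightarrow> complex"
    and q :: complex
  assumes \<theta>: "nontriv_add_char \<theta>"
  defines "q \<equiv> of_nat CARD('a)"
begin

lemmas sum_ev_q = sum_ev[where 'a = 'a, folded q_def]
lemmas sum_mchars_q = sum_mchars[where 'a = 'a, folded q_def]

abbreviation G :: "'a mchar \<Rightarrow> complex" where "G \<chi> \<equiv> gauss_sum \<theta> (ev \<chi>)"

text \<open>A Gauss sum for the additive character dilated by \<open>m\<close>. Allowing
  \<open>m = 0\<close> lets trivial products of characters be treated together with the generic
  case.\<close>

definition H :: "'a mchar \<Rightarrow> 'a \<Rightarrow> complex" where
  "H \<chi> m = (\<Sum>x\<in>UNIV. ev \<chi> x * \<theta> (m * x))"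

lemma q_ge_2: "CARD('a) \<ge> 2"
  using card_mono[of "UNIV :: 'a set" "{0,1}"] by simp

lemma q_neq_0 [simp]: "q \<noteq> 0"
  using q_ge_2 by (simp add: q_def)

lemma q_neq_1 [simp]: "q - 1 \<noteq> 0" "q \<noteq> 1"
  using q_ge_2 by (simp_all add: q_def of_nat_eq_1_iff)

lemma \<theta>_add: "\<theta> (x + y) = \<theta> x * \<theta> y"
  using \<theta> by (simp add: nontriv_add_char_def)

lemma \<theta>_0 [simp]: "\<theta> 0 = 1"
  using \<theta>_add[of 0 0] \<theta> by (simp add: nontriv_add_char_def)

lemma sum_\<theta>: "(\<Sum>x\<in>UNIV. \<theta> (m * x)) = (if m = 0 then q else 0)"
proof (cases "m = 0")
  case False
  obtain y where y: "\<theta> y \<noteq> 1"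
    using \<theta> by (auto simp: nontriv_add_char_def)
  have "(\<Sum>x\<in>UNIV. \<theta> x) = (\<Sum>x\<in>UNIV. \<theta> (y + x))"
    by (rule sum.reindex_bij_witness[of _ "\<lambda>x. y + x" "\<lambda>x. x - y"]) auto
  then have "(\<Sum>x\<in>UNIV. \<theta> x) = \<theta> y * (\<Sum>x\<in>UNIV. \<theta> x)"
    unfolding \<theta>_add sum_distrib_left[symmetric] .
  with y False show ?thesis
    using sum_field_scale[OF False, of \<theta>] by simp
qed (simp add: q_def)

lemma H_0: "H \<chi> 0 = (if \<chi> = 0 then q - 1 else 0)"
  using sum_ev_q[of \<chi>] by (simp add: H_def)

lemma H_scale:
  assumes "c \<noteq> 0"
  shows "H \<chi> (c * m) = H \<chi> m / ev \<chi> c"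
proof -
  have "ev \<chi> c * H \<chi> (c * m) = (\<Sum>x\<in>UNIV. ev \<chi> (c * x) * \<theta> (m * (c * x)))"
    by (simp add: H_def sum_distrib_left ev_mult mult_ac)
  also have "\<dots> = H \<chi> m"
    unfolding H_def using sum_field_scale[OF assms, of "\<lambda>x. ev \<chi> x * \<theta> (m * x)"] .
  finally show ?thesis
    using assms by (simp add: field_simps)
qed

lemma H_1: "H \<chi> 1 = G \<chi>"
  by (simp add: H_def gauss_sum_def)

lemma H_nz: "m \<noteq> 0 \<Longrightarrow> H \<chi> m = G \<chi> / ev \<chi> m"
  using H_scale[of m \<chi> 1] by (simp add: H_1)

lemma H_nontriv: "\<chi> \<noteq> 0 \<Longrightarrow> H \<chi> m = G \<chi> / ev \<chi> m"
  by (cases "m = 0") (simp_all add: H_0 H_nz)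

lemma H_triv: "H 0 m = (if m = 0 then q else 0) - 1"
proof -
  have "(\<Sum>x\<in>UNIV. \<theta> (m * x)) = 1 + H 0 m"
    unfolding H_def by (subst (1 2) sum.remove[of UNIV 0]) (auto intro!: sum.cong)
  then show ?thesis
    unfolding sum_\<theta> by (simp add: algebra_simps split: if_splits)
qed

lemma G_0 [simp]: "G 0 = -1"
  using H_triv[of 1] by (simp add: H_1)

section \<open>Products and inverses of Gauss sums\<close>

text \<open>Substituting \<open>x = p * r\<close> in the double sum separates \<open>r\<close> from
  \<open>p\<close>; the terms with \<open>p = 0\<close> vanish. This is the Jacobi sum formula in a
  form valid for all characters, because \<open>H\<close> covers a trivial
  \<open>\<alpha> + \<beta>\<close>.\<close>

lemma gauss_prod:
  "G \<alpha> * G \<beta> = (\<Sum>r\<in>UNIV. ev \<alpha> r * H (\<alpha> + \<beta>) (1 + r))"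
proof -
  have "G \<alpha> * G \<beta> = (\<Sum>x\<in>UNIV. \<Sum>p\<in>UNIV. ev \<alpha> x * ev \<beta> p * \<theta> (x + p))"
    by (simp add: gauss_sum_def sum_product \<theta>_add mult_ac)
  also have "\<dots> = (\<Sum>p\<in>UNIV. \<Sum>x\<in>UNIV. ev \<alpha> x * ev \<beta> p * \<theta> (x + p))"
    by (rule sum.swap)
  also have "\<dots> = (\<Sum>p\<in>UNIV. \<Sum>r\<in>UNIV. ev \<alpha> r * (ev (\<alpha> + \<beta>) p * \<theta> ((1 + r) * p)))"
  proof (rule sum.cong)
    fix p :: 'a
    show "(\<Sum>x\<in>UNIV. ev \<alpha> x * ev \<beta> p * \<theta> (x + p)) =
      (\<Sum>r\<in>UNIV. ev \<alpha> r * (ev (\<alpha> + \<beta>) p * \<theta> ((1 + r) * p)))"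
    proof (cases "p = 0")
      case False
      then show ?thesis
        using sum_field_scale[OF False, of "\<lambda>x. ev \<alpha> x * ev \<beta> p * \<theta> (x + p)"]
        by (simp add: ev_mult algebra_simps)
    qed simp
  qed simp
  also have "\<dots> = (\<Sum>r\<in>UNIV. ev \<alpha> r * H (\<alpha> + \<beta>) (1 + r))"
    by (subst sum.swap) (simp add: H_def sum_distrib_left)
  finally show ?thesis .
qed

lemma G_reflection: "G \<chi> * G (- \<chi>) = q * ev \<chi> (-1) - (if \<chi> = 0 then q - 1 else 0)"
proof -
  have "G \<chi> * G (- \<chi>) = (\<Sum>r\<in>UNIV. (if r = -1 then q * ev \<chi> r else 0) - ev \<chi> r)"
    by (auto simp: gauss_prod H_triv add_eq_0_iff right_diff_distrib intro!: sum.cong)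
  then show ?thesis
    by (simp add: sum_subtractf sum_ev_q)
qed

lemma G_neq_0 [simp]: "G \<chi> \<noteq> 0"
proof (cases "\<chi> = 0")
  case False
  then have "G \<chi> * G (- \<chi>) \<noteq> 0"
    by (simp add: G_reflection)
  then show ?thesis
    by auto
qed simp

text \<open>Reflection moves a Gauss sum from a denominator to a numerator. The correction at the
  trivial character is what later cancels a degenerate term of Barnes' lemma.\<close>

lemma inverse_G: "1 / G \<chi> = ev \<chi> (-1) * G (- \<chi>) / q - (if \<chi> = 0 then (q - 1) / q else 0)"
proof (cases "\<chi> = 0")
  case False
  have "ev \<chi> (-1) * (G \<chi> * G (- \<chi>)) = q * (ev \<chi> (-1) * ev \<chi> (-1))"
    using False by (simp add: G_reflection)
  then show ?thesis
    using False by (simp add: field_simps)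
qed (simp add: field_simps)

section \<open>Barnes' first lemma\<close>

text \<open>A Parseval formula for Mellin transforms: summing over \<open>\<chi>\<close> keeps only
  the pairs with \<open>t * r * s = 1\<close>.\<close>

lemma sum_mchars_convolution:
  fixes t :: 'a
  assumes "t \<noteq> 0"
  shows "(\<Sum>\<chi>\<in>UNIV. (\<Sum>r\<in>UNIV. ev (a + \<chi>) r * f r) * (\<Sum>s\<in>UNIV. ev (b + \<chi>) s * h s) * ev \<chi> t) =
    (q - 1) * (\<Sum>r\<in>UNIV. ev a r * f r * (ev b (inverse (t * r)) * h (inverse (t * r))))"
proof -
  have "(\<Sum>\<chi>\<in>UNIV. (\<Sum>r\<in>UNIV. ev (a + \<chi>) r * f r) * (\<Sum>s\<in>UNIV. ev (b + \<chi>) s * h s) * ev \<chi> t) =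
    (\<Sum>\<chi>\<in>UNIV. \<Sum>r\<in>UNIV. \<Sum>s\<in>UNIV. ev a r * f r * (ev b s * h s) * ev \<chi> (t * r * s))"
    by (simp only: sum_product) (simp only: sum_distrib_left ev_plus ev_mult mult_ac)
  also have "\<dots> = (\<Sum>r\<in>UNIV. \<Sum>\<chi>\<in>UNIV. \<Sum>s\<in>UNIV. ev a r * f r * (ev b s * h s) * ev \<chi> (t * r * s))"
    by (rule sum.swap)
  also have "\<dots> = (\<Sum>r\<in>UNIV. (q - 1) * (ev a r * f r * (ev b (inverse (t * r)) * h (inverse (t * r)))))"
  proof (rule sum.cong)
    fix r :: 'a
    show "(\<Sum>\<chi>\<in>UNIV. \<Sum>s\<in>UNIV. ev a r * f r * (ev b s * h s) * ev \<chi> (t * r * s)) =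
      (q - 1) * (ev a r * f r * (ev b (inverse (t * r)) * h (inverse (t * r))))"
    proof (cases "r = 0")
      case False
      have "(\<Sum>\<chi>\<in>UNIV. \<Sum>s\<in>UNIV. ev a r * f r * (ev b s * h s) * ev \<chi> (t * r * s)) =
        (\<Sum>s\<in>UNIV. ev a r * f r * (ev b s * h s) * (\<Sum>\<chi>\<in>UNIV. ev \<chi> (t * r * s)))"
        by (subst sum.swap) (simp only: sum_distrib_left)
      also have "\<dots> = (\<Sum>s\<in>UNIV. if s = inverse (t * r)
          then (q - 1) * (ev a r * f r * (ev b s * h s)) else 0)"
        using assms False unfolding sum_mchars_q by (intro sum.cong) (auto simp: field_simps)
      finally show ?thesis
        by simp
    qed simp
  qed simp
  finally show ?thesis
    by (simp only: sum_distrib_left)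
qed

text \<open>Pairing \<open>a\<close> with \<open>c\<close> and \<open>b\<close> with
  \<open>d\<close> removes \<open>\<psi>\<close> from the index of each \<open>H\<close>, so the
  convolution formula applies with \<open>t = 1\<close>.\<close>

lemma barnes_first:
  "(\<Sum>\<psi>\<in>UNIV. G (a + \<psi>) * G (b + \<psi>) * G (c - \<psi>) * G (d - \<psi>)) =
    (q - 1) * (G (a + c) * G (a + d) * G (b + c) * G (b + d) / G (a + b + c + d) +
      (if a + b + c + d = 0 then q * (q - 1) * ev (a + b) (-1) else 0))"
proof -
  define e where "e = a + b + c + d"
  define L where "L = (\<Sum>r\<in>UNIV. ev (a + d) r * (H (a + c) (1 + r) * H (b + d) (1 + r)))"
  have "(\<Sum>\<psi>\<in>UNIV. G (a + \<psi>) * G (b + \<psi>) * G (c - \<psi>) * G (d - \<psi>)) =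
    (\<Sum>\<psi>\<in>UNIV. (G (a + \<psi>) * G (c - \<psi>)) * (G (b + \<psi>) * G (d - \<psi>)) * ev \<psi> 1)"
    by (simp add: mult_ac)
  also have "\<dots> = (q - 1) * (\<Sum>r\<in>UNIV. ev a r * H (a + c) (1 + r) *
      (ev b (inverse (1 * r)) * H (b + d) (1 + inverse (1 * r))))"
    by (subst sum_mchars_convolution[symmetric]) (simp_all add: gauss_prod)
  also have "(\<Sum>r\<in>UNIV. ev a r * H (a + c) (1 + r) *
      (ev b (inverse (1 * r)) * H (b + d) (1 + inverse (1 * r)))) = L"
    unfolding L_def
  proof (rule sum.cong)
    fix r :: 'a
    show "ev a r * H (a + c) (1 + r) * (ev b (inverse (1 * r)) * H (b + d) (1 + inverse (1 * r))) =
      ev (a + d) r * (H (a + c) (1 + r) * H (b + d) (1 + r))"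
    proof (cases "r = 0")
      case False
      \<comment> \<open>Scaling brings both \<open>H\<close> factors to the same argument
        \<open>1 + r\<close>.\<close>
      then have "1 + inverse r = inverse r * (1 + r)"
        by (simp add: field_simps)
      then have "H (b + d) (1 + inverse r) = H (b + d) (1 + r) * ev (b + d) r"
        using H_scale[of "inverse r" "b + d" "1 + r", unfolded ev_inverse] False
        by (simp add: divide_inverse)
      with False show ?thesis
        by (simp add: ev_inverse)
    qed simp
  qed simp
  also have "L = G (a + c) * G (a + d) * G (b + c) * G (b + d) / G e +
      (if e = 0 then q * (q - 1) * ev (a + b) (-1) else 0)"
  proof -
    \<comment> \<open>The point \<open>r = -1\<close> is split off, since there \<open>H\<close> is
      taken at \<open>0\<close>. In the remaining sum this point contributes nothing, because
      division by \<open>ev e 0 = 0\<close> gives \<open>0\<close>.\<close>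
    have L: "L = G (a + c) * G (b + d) * (\<Sum>r\<in>UNIV. ev (a + d) r / ev e (1 + r)) +
      ev (a + d) (-1) * (H (a + c) 0 * H (b + d) 0)"
    proof -
      have "ev (a + d) r * (H (a + c) (1 + r) * H (b + d) (1 + r)) =
        G (a + c) * G (b + d) * (ev (a + d) r / ev e (1 + r)) +
        (if r = -1 then ev (a + d) r * (H (a + c) 0 * H (b + d) 0) else 0)" for r
      proof (cases "r = -1")
        case False
        then have "1 + r \<noteq> 0"
          by (metis add_eq_0_iff)
        with False show ?thesis
          by (simp add: H_nz e_def mult_ac)
      qed simp
      then show ?thesis
        unfolding L_def by (simp add: sum.distrib sum_distrib_left)
    qed
    show ?thesis
    proof (cases "e = 0")
      case False
      have "G (a + d) * G (b + c) = (\<Sum>r\<in>UNIV. ev (a + d) r * H e (1 + r))"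
        by (simp only: gauss_prod e_def add_ac)
      then have "(\<Sum>r\<in>UNIV. ev (a + d) r / ev e (1 + r)) = G (a + d) * G (b + c) / G e"
        using False by (simp add: H_nontriv sum_distrib_left[symmetric] flip: times_divide_eq_right sum_divide_distrib)
          (simp add: field_simps sum_distrib_left)
      moreover have "H (a + c) 0 * H (b + d) 0 = 0"
      proof -
        have "e = (a + c) + (b + d)"
          by (simp add: e_def add_ac)
        with False show ?thesis
          by (auto simp: H_0)
      qed
      ultimately show ?thesis
        using False unfolding L by (auto simp: mult_ac)
    next
      case True
      define \<alpha> \<beta> where "\<alpha> = a + c" and "\<beta> = a + d"
      have eqs: "b + d = - \<alpha>" "b + c = - \<beta>"
        using True by (simp_all add: \<alpha>_def \<beta>_def e_def algebra_simps add_eq_0_iff)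
      \<comment> \<open>Up to squares of characters and \<open>e\<close>, which is trivial here,
        \<open>a + b\<close> is \<open>\<alpha> + \<beta>\<close>; squares take the value
        \<open>1\<close> at \<open>-1\<close>.\<close>
      have sgn: "ev (a + b) (-1) = ev \<alpha> (-1) * ev \<beta> (-1)"
      proof -
        have "a + b = \<alpha> + \<beta> - (a + a) - (c + c) - (d + d) + e"
          by (simp add: \<alpha>_def \<beta>_def e_def algebra_simps)
        then show ?thesis
          using True by simp
      qed
      have "(\<Sum>r\<in>UNIV. ev \<beta> r / ev e (1 + r)) = (\<Sum>r\<in>UNIV. ev \<beta> r - (if r = -1 then ev \<beta> r else 0))"
        using True by (intro sum.cong) (auto simp: add_eq_0_iff)
      also have "\<dots> = (if \<beta> = 0 then q - 1 else 0) - ev \<beta> (-1)"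
        by (simp add: sum_subtractf sum_ev_q)
      finally have "L = (G \<alpha> * G (- \<alpha>)) * ((if \<beta> = 0 then q - 1 else 0) - ev \<beta> (-1)) +
          ev \<beta> (-1) * (if \<alpha> = 0 then (q - 1) * (q - 1) else 0)"
        unfolding L eqs \<alpha>_def[symmetric] \<beta>_def[symmetric] by (simp add: H_0)
      also have "\<dots> = - (G \<alpha> * G (- \<alpha>)) * (G \<beta> * G (- \<beta>)) + q * (q - 1) * (ev \<alpha> (-1) * ev \<beta> (-1))"
        unfolding G_reflection by (simp add: algebra_simps)
      finally show ?thesis
        unfolding eqs sgn \<alpha>_def[symmetric] \<beta>_def[symmetric] using True by simp
    qed
  qed
  finally show ?thesis
    unfolding e_def .
qed

section \<open>Kummer's and Dixon's theorems\<close>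

text \<open>With \<open>G (A + \<chi>)\<close> paired to \<open>G (B - A - \<chi>)\<close> and
  \<open>G (B + \<chi>)\<close> to \<open>G (- \<chi>)\<close>, both pairs have product character
  \<open>B\<close>. Convolution at \<open>-1\<close> then gives
  \<open>H B (1 + r) * H B (1 - r)\<close>, which for nontrivial \<open>B\<close> depends only on
  the square of \<open>r\<close>.\<close>

lemma kummer:
  assumes "(-1::'a) \<noteq> 1"
  shows "(\<Sum>\<chi>\<in>UNIV. G (A + \<chi>) * G (- \<chi>) * G (B + \<chi>) * G (B - A - \<chi>) * ev \<chi> (-1)) =
    (q - 1) * (\<Sum>R | R + R = A. ev R (-1) * G R * G B * G (B - R))"
proof -
  have "(\<Sum>\<chi>\<in>UNIV. G (A + \<chi>) * G (- \<chi>) * G (B + \<chi>) * G (B - A - \<chi>) * ev \<chi> (-1)) =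
    (\<Sum>\<chi>\<in>UNIV. (G (A + \<chi>) * G (B - A - \<chi>)) * (G (B + \<chi>) * G (- \<chi>)) * ev \<chi> (-1))"
    by (simp only: mult_ac)
  also have "\<dots> = (q - 1) * (\<Sum>r\<in>UNIV. ev A r * H B (1 + r) *
      (ev B (inverse (-1 * r)) * H B (1 + inverse (-1 * r))))"
    by (subst sum_mchars_convolution[symmetric]) (simp_all add: gauss_prod)
  also have "(\<Sum>r\<in>UNIV. ev A r * H B (1 + r) *
      (ev B (inverse (-1 * r)) * H B (1 + inverse (-1 * r)))) =
    (\<Sum>r\<in>UNIV. ev A r * H B (1 + r) * H B (1 - r))"
  proof (rule sum.cong)
    fix r :: 'a
    show "ev A r * H B (1 + r) * (ev B (inverse (-1 * r)) * H B (1 + inverse (-1 * r))) =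
      ev A r * H B (1 + r) * H B (1 - r)"
    proof (cases "r = 0")
      case False
      then have "1 + inverse (-1 * r) = inverse (-1 * r) * (1 - r)"
        by (simp add: field_simps)
      then have "H B (1 + inverse (-1 * r)) = H B (1 - r) / ev B (inverse (-1 * r))"
        using H_scale[of "inverse (-1 * r)" B "1 - r"] False by simp
      with False show ?thesis
        by simp
    qed simp
  qed simp
  also have "\<dots> = (\<Sum>R | R + R = A. ev R (-1) * G R * G B * G (B - R))"
  \<comment> \<open>For trivial \<open>B\<close> the function \<open>H B\<close> jumps at
    \<open>0\<close>, so the points \<open>r = 1\<close> and \<open>r = -1\<close>, distinct by
    assumption, are accounted for separately.\<close>
  proof (cases "B = 0")
    case True
    have "(\<Sum>r\<in>UNIV. ev A r * H B (1 + r) * H B (1 - r)) =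
      (\<Sum>r\<in>UNIV. ev A r - (if r = -1 then q * ev A r else 0) - (if r = 1 then q * ev A r else 0))"
      using True assms
      by (intro sum.cong) (auto simp: H_triv add_eq_0_iff right_diff_distrib left_diff_distrib)
    also have "\<dots> = (if A = 0 then q - 1 else 0) - q * (ev A (-1) + 1)"
      by (simp add: sum_subtractf sum_ev_q) (simp add: algebra_simps)
    also have "ev A (-1) + 1 = (\<Sum>R | R + R = A. ev R 1)"
    proof -
      have "{u::'a. u * u = 1} = {1, -1}"
        by (auto simp: square_eq_1_iff)
      then show ?thesis
        unfolding sum_square_roots using assms by simp
    qed
    \<comment> \<open>The trivial character is among the roots \<open>R\<close> exactly when
      \<open>A = 0\<close>, so the first term can be moved into the sum.\<close>
    also have "(if A = 0 then q - 1 else 0) - q * (\<Sum>R | R + R = A. ev R 1) =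
      (\<Sum>R | R + R = A. (if R = 0 then q - 1 else 0) - q)"
    proof -
      have "(\<Sum>R | R + R = A. if R = 0 then q - 1 else 0) = (if A = 0 then q - 1 else 0)"
        by (simp add: sum.If_cases)
      then show ?thesis
        by (simp add: sum_subtractf mult.commute)
    qed
    also have "\<dots> = (\<Sum>R | R + R = A. ev R (-1) * G R * G B * G (B - R))"
    proof (rule sum.cong)
      fix R :: "'a mchar"
      have "ev R (-1) * (G R * G (- R)) = q - (if R = 0 then q - 1 else 0)"
        unfolding G_reflection by (simp add: algebra_simps)
      then show "(if R = 0 then q - 1 else 0) - q = ev R (-1) * G R * G B * G (B - R)"
        using True by (simp add: algebra_simps)
    qed simp
    finally show ?thesis .
  next
    case False
    have "(\<Sum>r\<in>UNIV. ev A r * H B (1 + r) * H B (1 - r)) =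
      (\<Sum>r\<in>UNIV. G B * G B * (ev A r / ev B (1 - r * r)))"
    proof (rule sum.cong)
      fix r :: 'a
      have "ev B (1 - r * r) = ev B (1 + r) * ev B (1 - r)"
        by (simp add: algebra_simps flip: ev_mult)
      then show "ev A r * H B (1 + r) * H B (1 - r) = G B * G B * (ev A r / ev B (1 - r * r))"
        using False by (simp add: H_nontriv)
    qed simp
    \<comment> \<open>Grouping by \<open>v = r * r\<close> lets \<open>sum_square_roots\<close>
      trade roots of \<open>v\<close> for roots of \<open>A\<close>.\<close>
    also have "\<dots> = G B * G B * (\<Sum>v\<in>UNIV. \<Sum>r | r * r = v. ev A r / ev B (1 - r * r))"
      using sum.group[of UNIV UNIV "\<lambda>r. r * r" "\<lambda>r. ev A r / ev B (1 - r * r)"]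
      by (simp add: sum_distrib_left)
    also have "(\<Sum>v\<in>UNIV. \<Sum>r | r * r = v. ev A r / ev B (1 - r * r)) =
      (\<Sum>v\<in>UNIV. (\<Sum>R | R + R = A. ev R v) / ev B (1 - v))"
      unfolding sum_square_roots by (simp add: sum_divide_distrib)
    also have "\<dots> = (\<Sum>R | R + R = A. \<Sum>v\<in>UNIV. ev R v / ev B (1 - v))"
      unfolding sum_divide_distrib by (rule sum.swap)
    \<comment> \<open>One factor \<open>G B\<close> is absorbed into \<open>H B\<close>, preparing
      for \<open>gauss_prod\<close> read backwards.\<close>
    also have "G B * G B * \<dots> = (\<Sum>R | R + R = A. G B * (\<Sum>v\<in>UNIV. ev R v * H B (1 - v)))"
      using False by (simp add: H_nontriv sum_distrib_left mult_ac)
    also have "\<dots> = (\<Sum>R | R + R = A. ev R (-1) * G R * G B * G (B - R))"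
    proof (rule sum.cong)
      fix R :: "'a mchar"
      have "(\<Sum>v\<in>UNIV. ev R v * H B (1 - v)) = (\<Sum>r\<in>UNIV. ev R (- r) * H B (1 + r))"
        using sum_field_scale[of "-1" "\<lambda>v. ev R v * H B (1 - v)"] by simp
      also have "\<dots> = ev R (-1) * (G R * G (B - R))"
      proof -
        have "G R * G (B - R) = (\<Sum>r\<in>UNIV. ev R r * H B (1 + r))"
          using gauss_prod[of R "B - R"] by simp
        moreover have "ev R (- r) * H B (1 + r) = ev R (-1) * (ev R r * H B (1 + r))" for r
          by (subst ev_neg) (rule mult.assoc)
        ultimately show ?thesis
          by (simp only: sum_distrib_left)
      qed
      finally show "G B * (\<Sum>v\<in>UNIV. ev R v * H B (1 - v)) = ev R (-1) * G R * G B * G (B - R)"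
        by (simp add: mult_ac)
    qed simp
    finally show ?thesis .
  qed
  finally show ?thesis .
qed

text \<open>Barnes' lemma at \<open>C\<close>, \<open>D\<close>, \<open>\<chi>\<close>,
  \<open>- A - \<chi>\<close>. The sum of these four does not involve \<open>\<chi>\<close>, so the
  factor \<open>G (C + D - A)\<close> and the degenerate term come out of any later sum over
  \<open>\<chi>\<close>.\<close>

lemma barnes_well_poised:
  "(q - 1) * (G (C + \<chi>) * G (C - A - \<chi>) * G (D + \<chi>) * G (D - A - \<chi>)) =
    G (C + D - A) * ((\<Sum>\<psi>\<in>UNIV. G (C + \<psi>) * G (D + \<psi>) * G (\<chi> - \<psi>) * G (- A - \<chi> - \<psi>)) -
      (if C + D = A then q * (q - 1) * (q - 1) * ev A (-1) else 0))"
proof -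
  have "C + (- A - \<chi>) = C - A - \<chi>" "D + (- A - \<chi>) = D - A - \<chi>"
    "C + D + \<chi> + (- A - \<chi>) = C + D - A" "C + D - A = 0 \<longleftrightarrow> C + D = A"
    by (simp_all add: algebra_simps)
  then show ?thesis
    using barnes_first[of C D \<chi> "- A - \<chi>"] by (auto simp: field_simps simp del: ev_plus)
qed

text \<open>After inverting the variable in \<open>G (- \<chi>)\<close>, convolution at
  \<open>-1\<close> pairs \<open>\<theta> r\<close> with \<open>\<theta> (- r)\<close>. Their
  product is \<open>1\<close>, which leaves a plain sum of \<open>A\<close>.\<close>

lemma sum_G_reflect:
  "(\<Sum>\<chi>\<in>UNIV. G (A + \<chi>) * G (- \<chi>) * ev \<chi> (-1)) = (if A = 0 then (q - 1) * (q - 1) else 0)"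
proof -
  have "(\<Sum>\<chi>\<in>UNIV. G (A + \<chi>) * G (- \<chi>) * ev \<chi> (-1)) =
    (\<Sum>\<chi>\<in>UNIV. (\<Sum>r\<in>UNIV. ev (A + \<chi>) r * \<theta> r) * (\<Sum>s\<in>UNIV. ev (0 + \<chi>) s * \<theta> (inverse s)) * ev \<chi> (-1))"
  proof (rule sum.cong)
    fix \<chi> :: "'a mchar"
    have "G (- \<chi>) = (\<Sum>s\<in>UNIV. ev \<chi> s * \<theta> (inverse s))"
      unfolding gauss_sum_def
      by (rule sum.reindex_bij_witness[of _ inverse inverse]) (auto simp: ev_inverse)
    then show "G (A + \<chi>) * G (- \<chi>) * ev \<chi> (-1) = (\<Sum>r\<in>UNIV. ev (A + \<chi>) r * \<theta> r) *
        (\<Sum>s\<in>UNIV. ev (0 + \<chi>) s * \<theta> (inverse s)) * ev \<chi> (-1)"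
      by (simp add: gauss_sum_def)
  qed simp
  also have "\<dots> = (q - 1) * (\<Sum>r\<in>UNIV. ev A r)"
    by (subst sum_mchars_convolution) (auto intro!: sum.cong simp: mult.assoc simp flip: \<theta>_add)
  finally show ?thesis
    by (simp add: sum_ev_q)
qed

text \<open>All Gauss sums on the right stand in numerators, so the formula can be summed further
  over \<open>E\<close>, which \<open>well_poised_reduction\<close> sets to
  \<open>- \<psi>\<close>.\<close>

lemma dixon:
  assumes "(-1::'a) \<noteq> 1" "A \<noteq> 0" "B \<noteq> 0" "B + B \<noteq> A"
  shows "(\<Sum>\<chi>\<in>UNIV. G (A + \<chi>) * G (- \<chi>) * (G (B + \<chi>) * G (B - A - \<chi>) * G (E + \<chi>) * G (E - A - \<chi>)) * ev \<chi> (-1)) =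
    (q - 1) * G (B + E - A) / q *
      (\<Sum>R | R + R = A. ev (B + E) (-1) * G R * G B * G E * G (B - R) * G (E - R) * G (R - B - E))"
proof -
  let ?S = "\<Sum>\<chi>\<in>UNIV. G (A + \<chi>) * G (- \<chi>) * (G (B + \<chi>) * G (B - A - \<chi>) * G (E + \<chi>) * G (E - A - \<chi>)) * ev \<chi> (-1)"
  let ?c = "if B + E = A then q * (q - 1) * (q - 1) * ev A (-1) else 0"
  have "(q - 1) * ?S = (\<Sum>\<chi>\<in>UNIV. G (A + \<chi>) * G (- \<chi>) *
      ((q - 1) * (G (B + \<chi>) * G (B - A - \<chi>) * G (E + \<chi>) * G (E - A - \<chi>))) * ev \<chi> (-1))"
    by (simp only: sum_distrib_left mult_ac)
  also have "\<dots> = G (B + E - A) * ((\<Sum>\<chi>\<in>UNIV. \<Sum>\<psi>\<in>UNIV. G (B + \<psi>) * G (E + \<psi>) *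
      (G (A + \<chi>) * G (- \<chi>) * G (- \<psi> + \<chi>) * G (- \<psi> - A - \<chi>) * ev \<chi> (-1))) -
      ?c * (\<Sum>\<chi>\<in>UNIV. G (A + \<chi>) * G (- \<chi>) * ev \<chi> (-1)))"
  proof -
    have "- \<psi> + \<chi> = \<chi> - \<psi>" "- \<psi> - A - \<chi> = - A - \<chi> - \<psi>" for \<chi> \<psi> :: "'a mchar"
      by (simp_all add: algebra_simps)
    then show ?thesis
      unfolding barnes_well_poised
      by (simp only: sum_distrib_left sum_distrib_right right_diff_distrib left_diff_distrib sum_subtractf mult_ac)
  qed
  \<comment> \<open>The degenerate term of the first use of Barnes' lemma disappears because
    \<open>A\<close> is nontrivial.\<close>
  also have "(\<Sum>\<chi>\<in>UNIV. G (A + \<chi>) * G (- \<chi>) * ev \<chi> (-1)) = 0"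
    using assms by (simp add: sum_G_reflect del: ev_plus)
  also have "(\<Sum>\<chi>\<in>UNIV. \<Sum>\<psi>\<in>UNIV. G (B + \<psi>) * G (E + \<psi>) *
      (G (A + \<chi>) * G (- \<chi>) * G (- \<psi> + \<chi>) * G (- \<psi> - A - \<chi>) * ev \<chi> (-1))) =
    (\<Sum>\<psi>\<in>UNIV. G (B + \<psi>) * G (E + \<psi>) *
      (\<Sum>\<chi>\<in>UNIV. G (A + \<chi>) * G (- \<chi>) * G (- \<psi> + \<chi>) * G (- \<psi> - A - \<chi>) * ev \<chi> (-1)))"
    unfolding sum_distrib_left by (rule sum.swap)
  \<comment> \<open>Kummer's theorem with \<open>- \<psi>\<close> in the role of
    \<open>B\<close>.\<close>
  also have "\<dots> = (\<Sum>\<psi>\<in>UNIV. G (B + \<psi>) * G (E + \<psi>) *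
      ((q - 1) * (\<Sum>R | R + R = A. ev R (-1) * G R * G (- \<psi>) * G (- \<psi> - R))))"
    unfolding kummer[OF assms(1)] ..
  also have "\<dots> = (q - 1) * (\<Sum>R | R + R = A. ev R (-1) * G R *
      (\<Sum>\<psi>\<in>UNIV. G (B + \<psi>) * G (E + \<psi>) * G (0 - \<psi>) * G (- R - \<psi>)))"
    unfolding sum_distrib_left by (subst sum.swap) (simp add: mult_ac minus_diff_commute)
  also have "\<dots> = (q - 1) * (\<Sum>R | R + R = A. (q - 1) / q *
      (ev (B + E) (-1) * G R * G B * G E * G (B - R) * G (E - R) * G (R - B - E)))"
  proof -
    have "ev R (-1) * G R * (\<Sum>\<psi>\<in>UNIV. G (B + \<psi>) * G (E + \<psi>) * G (0 - \<psi>) * G (- R - \<psi>)) =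
      (q - 1) / q * (ev (B + E) (-1) * G R * G B * G E * G (B - R) * G (E - R) * G (R - B - E))"
      if R: "R + R = A" for R
    proof -
      let ?X = "G B * G (B - R) * G E * G (E - R)"
      have eqs: "B + E + 0 + - R = B + E - R" "- (B + E - R) = R - B - E"
        by (simp_all add: algebra_simps)
      \<comment> \<open>The second use of Barnes' lemma leaves this Gauss sum in the
        denominator.\<close>
      have inv: "1 / G (B + E - R) = ev (B + E - R) (-1) * G (R - B - E) / q -
          (if B + E - R = 0 then (q - 1) / q else 0)"
        using inverse_G[of "B + E - R"] unfolding eqs .
      have "(\<Sum>\<psi>\<in>UNIV. G (B + \<psi>) * G (E + \<psi>) * G (0 - \<psi>) * G (- R - \<psi>)) =
        (q - 1) * (?X * (1 / G (B + E - R)) +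
          (if B + E - R = 0 then q * (q - 1) * ev (B + E) (-1) else 0))"
        using barnes_first[of B E 0 "- R"] unfolding eqs by simp
      also have "?X * (1 / G (B + E - R)) + (if B + E - R = 0 then q * (q - 1) * ev (B + E) (-1) else 0) =
        ?X * (ev (B + E - R) (-1) * G (R - B - E) / q)"
      proof (cases "B + E - R = 0")
        case True
        then have "E = - (B - R)" "E - R = - B" "R = B + E"
          by (simp_all add: algebra_simps)
        \<comment> \<open>This is where \<open>B \<noteq> \<epsilon>\<close> and \<open>B\<^sup>2 \<noteq> A\<close> make the two degenerate contributions cancel.\<close>
        have "B - R \<noteq> 0"
          using R assms(4) by auto
        have "?X = (G B * G (- B)) * (G (B - R) * G (- (B - R)))"
          using \<open>E = - (B - R)\<close> \<open>E - R = - B\<close> by (simp only: mult_ac)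
        also have "\<dots> = q * q * ev R (-1)"
          unfolding G_reflection using assms(3) \<open>B - R \<noteq> 0\<close> by (simp add: mult_ac)
        finally have X: "?X = q * q * ev (B + E) (-1)"
          using \<open>R = B + E\<close> by simp
        show ?thesis
          unfolding inv X using True by (simp add: field_simps)
      qed (simp add: inv)
      finally have sum: "(\<Sum>\<psi>\<in>UNIV. G (B + \<psi>) * G (E + \<psi>) * G (0 - \<psi>) * G (- R - \<psi>)) =
        (q - 1) * (?X * (ev (B + E - R) (-1) * G (R - B - E) / q))" .
      show ?thesis
        unfolding sum by (simp add: mult_ac)
    qed
    then show ?thesis
      by (intro arg_cong[of _ _ "\<lambda>z. (q - 1) * z"] sum.cong refl) (simp only: mem_Collect_eq)
  qed
  finally have "(q - 1) * ?S = (q - 1) * ((q - 1) * G (B + E - A) / q * (\<Sum>R | R + R = A.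
      ev (B + E) (-1) * G R * G B * G E * G (B - R) * G (E - R) * G (R - B - E)))"
    unfolding sum_distrib_left[symmetric]
    by (simp only: mult_zero_left mult_zero_right diff_zero times_divide_eq_left times_divide_eq_right mult_ac)
  then show ?thesis
    by (simp only: mult_cancel_left q_neq_1 simp_thms)
qed

section \<open>The well-poised series\<close>

text \<open>Barnes' lemma on \<open>C\<close>, \<open>D\<close>, followed by Dixon's theorem in the
  inner sum. The degenerate term keeps the factors in \<open>A\<close> and \<open>B\<close>, whose
  sum is the numerator of the \<open>2F1\<close>.\<close>

lemma well_poised_reduction:
  assumes "(-1::'a) \<noteq> 1" "A \<noteq> 0" "B \<noteq> 0" "B + B \<noteq> A"
  shows "(\<Sum>\<chi>\<in>UNIV. G (A + \<chi>) * G (- \<chi>) * G (B + \<chi>) * G (B - A - \<chi>) * ev \<chi> (-1) *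
      (G (C + \<chi>) * G (C - A - \<chi>) * G (D + \<chi>) * G (D - A - \<chi>))) =
    G (C + D - A) * G B * ev B (-1) / q *
      (\<Sum>R | R + R = A. G R * G (B - R) *
        (\<Sum>\<psi>\<in>UNIV. G (R - B + \<psi>) * G (C + \<psi>) * G (D + \<psi>) * G (- R - \<psi>) * G (B - A - \<psi>) * G (- \<psi>) *
          ev \<psi> (-1))) +
    (if C + D = A then q * (q - 1) * ev A (-1) *
      (\<Sum>\<chi>\<in>UNIV. G (A + \<chi>) * G (- \<chi>) * G (B + \<chi>) * G (B - A - \<chi>) * ev \<chi> (-1)) else 0)"
    (is "?S = ?lhs / q * ?T + (if _ then _ * ?K else 0)")
proof -
  let ?P = "\<lambda>\<chi>. G (A + \<chi>) * G (- \<chi>) * G (B + \<chi>) * G (B - A - \<chi>) * ev \<chi> (-1)"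
  let ?c = "if C + D = A then q * (q - 1) * (q - 1) * ev A (-1) else 0"
  have "(q - 1) * ?S = (\<Sum>\<chi>\<in>UNIV. ?P \<chi> *
      ((q - 1) * (G (C + \<chi>) * G (C - A - \<chi>) * G (D + \<chi>) * G (D - A - \<chi>))))"
    by (simp only: sum_distrib_left mult_ac)
  also have "\<dots> = G (C + D - A) * ((\<Sum>\<chi>\<in>UNIV. \<Sum>\<psi>\<in>UNIV. G (C + \<psi>) * G (D + \<psi>) *
      (G (A + \<chi>) * G (- \<chi>) * (G (B + \<chi>) * G (B - A - \<chi>) * G (- \<psi> + \<chi>) * G (- \<psi> - A - \<chi>)) * ev \<chi> (-1))) -
      ?c * ?K)"
  proof -
    have "- \<psi> + \<chi> = \<chi> - \<psi>" "- \<psi> - A - \<chi> = - A - \<chi> - \<psi>" for \<chi> \<psi> :: "'a mchar"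
      by (simp_all add: algebra_simps)
    then show ?thesis
      unfolding barnes_well_poised
      by (simp only: sum_distrib_left sum_distrib_right right_diff_distrib left_diff_distrib sum_subtractf mult_ac)
  qed
  also have "(\<Sum>\<chi>\<in>UNIV. \<Sum>\<psi>\<in>UNIV. G (C + \<psi>) * G (D + \<psi>) *
      (G (A + \<chi>) * G (- \<chi>) * (G (B + \<chi>) * G (B - A - \<chi>) * G (- \<psi> + \<chi>) * G (- \<psi> - A - \<chi>)) * ev \<chi> (-1))) =
    (\<Sum>\<psi>\<in>UNIV. G (C + \<psi>) * G (D + \<psi>) * (\<Sum>\<chi>\<in>UNIV.
      G (A + \<chi>) * G (- \<chi>) * (G (B + \<chi>) * G (B - A - \<chi>) * G (- \<psi> + \<chi>) * G (- \<psi> - A - \<chi>)) * ev \<chi> (-1)))"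
    unfolding sum_distrib_left by (rule sum.swap)
  also have "\<dots> = (\<Sum>\<psi>\<in>UNIV. G (C + \<psi>) * G (D + \<psi>) * ((q - 1) * G (B + - \<psi> - A) / q *
      (\<Sum>R | R + R = A. ev (B + - \<psi>) (-1) * G R * G B * G (- \<psi>) * G (B - R) * G (- \<psi> - R) * G (R - B - - \<psi>))))"
    unfolding dixon[OF assms] ..
  also have "\<dots> = (q - 1) * (G B * ev B (-1) / q * ?T)"
  proof -
    have eqs: "B + - \<psi> - A = B - A - \<psi>" "R - B - - \<psi> = R - B + \<psi>"
      for \<psi> R :: "'a mchar"
      by (simp_all add: algebra_simps)
    have sgn: "ev (B + - \<psi>) (-1) = ev B (-1) * ev \<psi> (-1)" for \<psi>
      by simp
    show ?thesis
      unfolding eqs sgn sum_distrib_left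
      by (subst sum.swap) (simp only: mult_ac minus_diff_commute times_divide_eq_left times_divide_eq_right)
  qed
  finally have "(q - 1) * ?S = (q - 1) * (?lhs / q * ?T) - G (C + D - A) * (?c * ?K)"
    by (simp only: right_diff_distrib mult_ac times_divide_eq_left times_divide_eq_right)
  also have "\<dots> = (q - 1) * (?lhs / q * ?T + (if C + D = A then q * (q - 1) * ev A (-1) * ?K else 0))"
  proof (cases "C + D = A")
    case True
    \<comment> \<open>The Gauss sum of the trivial character is \<open>-1\<close>, so the subtracted
      degenerate term is added in the end.\<close>
    then have "G (C + D - A) = -1"
      by simp
    moreover have "(q - 1) * x - -1 * (q * (q - 1) * (q - 1) * e * k) = (q - 1) * (x + q * (q - 1) * e * k)"
      for x e k :: complex
      by (simp add: algebra_simps)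
    ultimately show ?thesis
      unfolding if_P[OF True] by (simp only:)
  qed simp
  finally show ?thesis
    by (simp only: mult_cancel_left q_neq_1 simp_thms)
qed

text \<open>Replacing \<open>\<chi>\<close> by \<open>- A - \<chi>\<close> swaps the Gauss sums in
  pairs; only the sign \<open>ev \<chi> (-1)\<close> changes, by \<open>ev A (-1)\<close>.\<close>

lemma well_poised_reflect:
  "(\<Sum>\<chi>\<in>UNIV. G (A + \<chi>) * G (- \<chi>) * G (B + \<chi>) * G (B - A - \<chi>) * ev \<chi> (-1) *
      (G (C + \<chi>) * G (C - A - \<chi>) * G (D + \<chi>) * G (D - A - \<chi>))) =
   ev A (-1) * (\<Sum>\<chi>\<in>UNIV. G (A + \<chi>) * G (- \<chi>) * G (B + \<chi>) * G (B - A - \<chi>) * ev \<chi> (-1) *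
      (G (C + \<chi>) * G (C - A - \<chi>) * G (D + \<chi>) * G (D - A - \<chi>)))"
  (is "(\<Sum>\<chi>\<in>UNIV. ?f \<chi>) = _")
proof -
  have "?f (- A - \<chi>) = ev A (-1) * ?f \<chi>" for \<chi>
  proof -
    have eqsA: "A + (- A - \<chi>) = - \<chi>" "- (- A - \<chi>) = A + \<chi>"
      by (simp_all add: algebra_simps)
    have eqs: "X + (- A - \<chi>) = X - A - \<chi>" "X - A - (- A - \<chi>) = X + \<chi>" for X :: "'a mchar"
      by (simp_all add: algebra_simps)
    have sgn: "ev (- A - \<chi>) (-1) = ev A (-1) * ev \<chi> (-1)"
      by simp
    show ?thesis
      unfolding eqsA unfolding eqs sgn by (simp only: mult_ac)
  qed
  then show ?thesis
    using sum_mchar_reflect[of ?f A] by (simp only: sum_distrib_left)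
qed

text \<open>By \<open>sum_square_roots\<close> at \<open>1\<close>, the values of \<open>A\<close>
  at the square roots of \<open>1\<close> add up to an empty sum over \<open>R\<close>.\<close>

lemma ev_neg1_of_nonsquare:
  fixes A :: "'a mchar"
  assumes "\<nexists>S. S + S = A"
  shows "ev A (-1) = -1"
proof -
  have sum: "(\<Sum>u::'a | u * u = 1. ev A u) = 0"
    using assms sum_square_roots[of 1 A] by simp
  have "{u::'a. u * u = 1} = {1, -1}"
    by (auto simp: square_eq_1_iff)
  with sum show ?thesis
    \<comment> \<open>If \<open>-1 = 1\<close>, the only root is \<open>1\<close> and the sum would
      be \<open>1\<close>, a contradiction.\<close>
    by (cases "(-1::'a) = 1") (auto simp: add_eq_0_iff)
qed

section \<open>Hypergeometric functions as quotients of Gauss sums\<close>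

lemma sum_mult_chars: "(\<Sum>\<chi>\<in>mult_chars. f \<chi>) = (\<Sum>\<chi>\<in>UNIV. f (ev (\<chi> :: 'a mchar)))"
proof -
  have "range ev = (mult_chars :: ('a \<Rightarrow> complex) set)"
    using type_definition.Rep_range[OF type_definition_mchar] .
  then show ?thesis
    by (metis (no_types, lifting) ev_inject injI sum.reindex_cong)
qed

text \<open>The even sign power is \<open>1\<close>, so the remaining \<open>ev \<chi> (-1)\<close>
  comes from the argument \<open>-1\<close>.\<close>

lemma hyp_F_4:
  "hyp_F \<theta> [ev A, ev B, ev C, ev D] [ev (A - B), ev (A - C), ev (A - D)] (-1) =
    (\<Sum>\<chi>\<in>UNIV. G (A + \<chi>) * G (- \<chi>) * G (B + \<chi>) * G (B - A - \<chi>) * ev \<chi> (-1) *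
      (G (C + \<chi>) * G (C - A - \<chi>) * G (D + \<chi>) * G (D - A - \<chi>))) /
    ((q - 1) * (G A * G B * G C * G D * G (B - A) * G (C - A) * G (D - A)))"
proof -
  have eqs: "- (A - X + \<chi>) = X - A - \<chi>" "- (A - X) = X - A" for X \<chi> :: "'a mchar"
    by (simp_all add: algebra_simps)
  have pow: "ev \<chi> (-1) ^ 4 = 1" for \<chi> :: "'a mchar"
    by (simp add: eval_nat_numeral)
  show ?thesis
    unfolding hyp_F_def sum_mult_chars
    by (simp add: eqs pow sum_divide_distrib sum_distrib_left mult_ac q_def
          flip: ev_plus_char ev_uminus_char)
qed

text \<open>Here the argument is \<open>1\<close>, and the odd sign power supplies
  \<open>ev \<psi> (-1)\<close>; the numerator is the inner sum in
  \<open>well_poised_reduction\<close>.\<close>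

lemma hyp_F_3:
  "hyp_F \<theta> [ev (R - B), ev C, ev D] [ev R, ev (A - B)] 1 =
    (\<Sum>\<psi>\<in>UNIV. G (R - B + \<psi>) * G (C + \<psi>) * G (D + \<psi>) * G (- R - \<psi>) * G (B - A - \<psi>) * G (- \<psi>) * ev \<psi> (-1)) /
    ((q - 1) * (G (R - B) * G C * G D * G (- R) * G (B - A)))"
proof -
  have eqs: "- (A - X + \<chi>) = X - A - \<chi>" "- (A - X) = X - A" "- (R + \<chi>) = - R - \<chi>" for X \<chi> :: "'a mchar"
    by (simp_all add: algebra_simps)
  have pow: "ev \<chi> (-1) ^ 3 = ev \<chi> (-1)" for \<chi> :: "'a mchar"
    by (simp add: eval_nat_numeral)
  show ?thesis
    unfolding hyp_F_def sum_mult_chars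
    by (simp add: eqs pow sum_divide_distrib sum_distrib_left mult_ac q_def
          flip: ev_plus_char ev_uminus_char)
qed

lemma hyp_F_2:
  "hyp_F \<theta> [ev A, ev B] [ev (A - B)] (-1) =
    (\<Sum>\<chi>\<in>UNIV. G (A + \<chi>) * G (- \<chi>) * G (B + \<chi>) * G (B - A - \<chi>) * ev \<chi> (-1)) /
    ((q - 1) * (G A * G B * G (B - A)))"
proof -
  have eqs: "- (A - X + \<chi>) = X - A - \<chi>" "- (A - X) = X - A" for X \<chi> :: "'a mchar"
    by (simp_all add: algebra_simps)
  have pow: "ev \<chi> (-1) ^ 2 = 1" for \<chi> :: "'a mchar"
    by (simp add: eval_nat_numeral)
  show ?thesis
    unfolding hyp_F_def sum_mult_chars
    by (simp add: eqs pow sum_divide_distrib sum_distrib_left mult_ac q_def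
          flip: ev_plus_char ev_uminus_char)
qed

lemma well_poised_nonsquare:
  assumes "\<nexists>S. S + S = A"
  shows "hyp_F \<theta> [ev A, ev B, ev C, ev D] [ev (A - B), ev (A - C), ev (A - D)] (-1) = 0"
  using well_poised_reflect[of A B C D] unfolding hyp_F_4 ev_neg1_of_nonsquare[OF assms] by auto

lemma well_poised_square:
  assumes "(-1::'a) \<noteq> 1" "S + S = A" "A \<noteq> 0" "B \<noteq> 0" "B + B \<noteq> A"
  shows "hyp_F \<theta> [ev A, ev B, ev C, ev D] [ev (A - B), ev (A - C), ev (A - D)] (-1) =
    G (- A) * G (- A + C + D) / (G (- A + C) * G (- A + D)) *
      (\<Sum>R | R + R = A. hyp_F \<theta> [ev (R - B), ev C, ev D] [ev R, ev (A - B)] 1) +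
    q * (q - 1) * (if - A + C + D = 0 then 1 else 0) / (G C * G (- C) * G (A - C) * G (- A + C)) *
      hyp_F \<theta> [ev A, ev B] [ev (A - B)] (-1)"
proof -
  let ?T = "\<lambda>R. \<Sum>\<psi>\<in>UNIV. G (R - B + \<psi>) * G (C + \<psi>) * G (D + \<psi>) * G (- R - \<psi>) * G (B - A - \<psi>) * G (- \<psi>) * ev \<psi> (-1)"
  let ?K = "\<Sum>\<chi>\<in>UNIV. G (A + \<chi>) * G (- \<chi>) * G (B + \<chi>) * G (B - A - \<chi>) * ev \<chi> (-1)"
  define T where "T = (\<Sum>R | R + R = A. G R * G (B - R) * ?T R)"
  have sgn: "ev A (-1) = 1"
    using assms(2) by auto
  have GA: "G (- A) = q / G A"
    using G_reflection[of A] assms(3) sgn by (simp add: field_simps)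
  have "(\<Sum>R | R + R = A. hyp_F \<theta> [ev (R - B), ev C, ev D] [ev R, ev (A - B)] 1) =
    (\<Sum>R | R + R = A. ev B (-1) / (q * q * (q - 1) * (G C * G D * G (B - A))) * (G R * G (B - R) * ?T R))"
  proof (rule sum.cong)
    fix R assume "R \<in> {R. R + R = A}"
    then have "R - B \<noteq> 0" "- R \<noteq> 0"
      using assms by auto
    \<comment> \<open>Both characters are nontrivial, so reflection carries no correction; this
      produces the weights \<open>G R * G (B - R)\<close> in \<open>T\<close>.\<close>
    then have inv: "1 / G (R - B) = ev R (-1) * ev B (-1) * G (B - R) / q" "1 / G (- R) = ev R (-1) * G R / q"
      using inverse_G[of "R - B"] inverse_G[of "- R"] by (simp_all del: right_minus_eq)
    have "hyp_F \<theta> [ev (R - B), ev C, ev D] [ev R, ev (A - B)] 1 =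
      1 / G (R - B) * (1 / G (- R)) * ?T R / ((q - 1) * (G C * G D * G (B - A)))"
      unfolding hyp_F_3 by (simp only: times_divide_eq_left times_divide_eq_right divide_divide_eq_left mult_1 mult_ac)
    also have "1 / G (R - B) * (1 / G (- R)) = ev B (-1) * G R * G (B - R) / (q * q)"
      unfolding inv by (simp add: mult_ac)
    finally show "hyp_F \<theta> [ev (R - B), ev C, ev D] [ev R, ev (A - B)] 1 =
      ev B (-1) / (q * q * (q - 1) * (G C * G D * G (B - A))) * (G R * G (B - R) * ?T R)"
      by (simp only: times_divide_eq_left times_divide_eq_right divide_divide_eq_left mult_ac)
  qed simp
  also have "\<dots> = ev B (-1) / (q * q * (q - 1) * (G C * G D * G (B - A))) * T"
    by (simp only: T_def sum_distrib_left)
  finally have sum3: "(\<Sum>R | R + R = A. hyp_F \<theta> [ev (R - B), ev C, ev D] [ev R, ev (A - B)] 1) =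
    ev B (-1) / (q * q * (q - 1) * (G C * G D * G (B - A))) * T" .
  have eqs: "- A + C + D = C + D - A" "- A + C = C - A" "- A + D = D - A"
    by (simp_all add: algebra_simps)
  have iff: "C + D - A = 0 \<longleftrightarrow> C + D = A"
    by simp
  define K where "K = ?K"
  \<comment> \<open>What remains is rational algebra in the Gauss sums, stated for arbitrary complex
    numbers. In \<open>alg0\<close> the delta factor is \<open>0\<close>, so \<open>m\<close> and
    \<open>n\<close> are unconstrained.\<close>
  have alg1: "(g * b * e / q * t + q * u * 1 * k) / (u * (a * b * c * d * ba * ca * da)) =
      q / a * g / (ca * da) * (e / (q * q * u * (c * d * ba)) * t) +
      q * u * 1 / (c * da * d * ca) * (k / (u * (a * b * ba)))"
    and alg0: "(g * b * e / q * t + 0) / (u * (a * b * c * d * ba * ca * da)) =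
      q / a * g / (ca * da) * (e / (q * q * u * (c * d * ba)) * t) + q * u * 0 / m * n"
    if "a \<noteq> 0" "b \<noteq> 0" "c \<noteq> 0" "d \<noteq> 0" "ba \<noteq> 0" "ca \<noteq> 0" "da \<noteq> 0" "u \<noteq> 0"
    for a b c d ba ca da e g k m n t u :: complex
    using that by (simp_all add: field_simps)
  note unfolds = hyp_F_4 hyp_F_2 sum3 well_poised_reduction[OF assms(1,3,4,5)] T_def[symmetric]
    K_def[symmetric] eqs(2,3) iff sgn GA
  show ?thesis
  proof (cases "C + D = A")
    case True
    \<comment> \<open>These identify the denominator of the \<open>2F1\<close> term with Gauss sums
      from the \<open>4F3\<close> denominator.\<close>
    then have eqs': "A - C = D" "D - A = - C"
      by auto
    show ?thesis
      unfolding eqs(1) unfolding unfolds if_P[OF True] unfolding eqs' by (rule alg1) simp_all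
  next
    case False
    show ?thesis
      unfolding eqs(1) unfolding unfolds if_not_P[OF False] by (rule alg0) simp_all
  qed
qed
end

section \<open>Transfer to characters as functions on the field\<close>

text \<open>Translation by \<open>1\<close> permutes the field, so comparing sums shows that
  \<open>CARD('a)\<close> is zero in it. If \<open>2\<close> were zero as well, odd cardinality
  would give \<open>1 = 0\<close>.\<close>

lemma neg_one_neq_one_if_odd_card:
  assumes "odd CARD('a::{field,finite})"
  shows "(-1::'a) \<noteq> 1"
proof
  assume "(-1::'a) = 1"
  then have two: "(2::'a) = 0"
    by (metis add.left_inverse one_add_one)
  have "(\<Sum>x\<in>UNIV. x + (1::'a)) = (\<Sum>x\<in>UNIV. x)"
    by (rule sum.reindex_bij_witness[of _ "\<lambda>x. x - 1" "\<lambda>x. x + 1"]) auto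
  then have "of_nat CARD('a) = (0::'a)"
    by (simp add: sum.distrib)
  with assms two show False
    by (auto elim!: oddE)
qed

lemma ev_minus_char: "ev (\<chi> - \<psi>) = ev \<chi> \<odot> char_inv (ev \<psi>)"
  unfolding diff_conv_add_uminus[of \<chi>] ev_plus_char ev_uminus_char ..

lemma char_delta_ev: "char_delta (ev \<chi>) = (if \<chi> = 0 then 1 else 0)"
  by (simp add: char_delta_def ev_inject flip: ev_zero_char)

lemma mult_chars_ev_cases:
  assumes "\<chi> \<in> mult_chars"
  obtains \<psi> where "\<chi> = ev \<psi>"
  using assms Abs_mchar_inverse by metis

lemma is_square_char_ev: "is_square_char (ev A) \<longleftrightarrow> (\<exists>S. S + S = A)"
  unfolding is_square_char_def by (metis ev ev_inject ev_plus_char mult_chars_ev_cases)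

lemma sum_square_roots_ev:
  "(\<Sum>R\<in>{R \<in> mult_chars. R \<odot> R = ev A}. f R) = (\<Sum>R | R + R = A. f (ev R))"
proof -
  have "{R \<in> mult_chars. R \<odot> R = ev A} = ev ` {R. R + R = A}"
    by (auto simp: ev ev_inject simp flip: ev_plus_char elim!: mult_chars_ev_cases)
  moreover have "inj_on ev {R. R + R = A}"
    by (simp add: inj_on_def ev_inject)
  ultimately show ?thesis
    by (simp add: sum.reindex)
qed

theorem theorem4p3:
  fixes \<theta> A B C D :: "'a::{field,finite} \<Rightarrow> complex"
  assumes "nontriv_add_char \<theta>"
    and "A \<in> mult_chars" and "B \<in> mult_chars" and "C \<in> mult_chars" and "D \<in> mult_chars"
  shows "(\<not> is_square_char A \<longrightarrow>
      hyp_F \<theta> [A, B, C, D] [A \<odot> char_inv B, A \<odot> char_inv C, A \<odot> char_inv D] (- 1) = 0) \<and>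
    (odd CARD('a) \<and> is_square_char A \<and> A \<noteq> triv_char \<and> B \<noteq> triv_char \<and> B \<odot> B \<noteq> A \<longrightarrow>
      hyp_F \<theta> [A, B, C, D] [A \<odot> char_inv B, A \<odot> char_inv C, A \<odot> char_inv D] (- 1) =
        gauss_sum \<theta> (char_inv A) * gauss_sum \<theta> (char_inv A \<odot> C \<odot> D) /
          (gauss_sum \<theta> (char_inv A \<odot> C) * gauss_sum \<theta> (char_inv A \<odot> D)) *
          (\<Sum>R\<in>{R \<in> mult_chars. R \<odot> R = A}.
             hyp_F \<theta> [R \<odot> char_inv B, C, D] [R, A \<odot> char_inv B] 1) +
        of_nat CARD('a) * (of_nat CARD('a) - 1) * char_delta (char_inv A \<odot> C \<odot> D) /
          (gauss_sum \<theta> C * gauss_sum \<theta> (char_inv C) *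
           gauss_sum \<theta> (A \<odot> char_inv C) * gauss_sum \<theta> (char_inv A \<odot> C)) *
          hyp_F \<theta> [A, B] [A \<odot> char_inv B] (- 1))"
proof -
  interpret gauss_sums \<theta> "of_nat CARD('a)"
    by unfold_locales (fact assms(1))
  obtain a b c d where ev_eqs: "A = ev a" "B = ev b" "C = ev c" "D = ev d"
    using assms(2-5) by (metis mult_chars_ev_cases)
  have nonsquare: "\<not> is_square_char A \<longrightarrow>
      hyp_F \<theta> [A, B, C, D] [A \<odot> char_inv B, A \<odot> char_inv C, A \<odot> char_inv D] (- 1) = 0"
    using well_poised_nonsquare[of a b c d] unfolding ev_eqs is_square_char_ev ev_minus_char by blast
  show ?thesis
  proof (intro conjI nonsquare impI, elim conjE)
    assume hyps: "odd CARD('a)" "is_square_char A" "A \<noteq> triv_char" "B \<noteq> triv_char" "B \<odot> B \<noteq> A"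
    obtain s where "s + s = a"
      using hyps(2) unfolding ev_eqs is_square_char_ev by blast
    moreover have "a \<noteq> 0" "b \<noteq> 0" "b + b \<noteq> a"
      using hyps(3-5) unfolding ev_eqs by (auto simp: ev_zero_char ev_plus_char)
    ultimately show "hyp_F \<theta> [A, B, C, D] [A \<odot> char_inv B, A \<odot> char_inv C, A \<odot> char_inv D] (- 1) =
        gauss_sum \<theta> (char_inv A) * gauss_sum \<theta> (char_inv A \<odot> C \<odot> D) /
          (gauss_sum \<theta> (char_inv A \<odot> C) * gauss_sum \<theta> (char_inv A \<odot> D)) *
          (\<Sum>R\<in>{R \<in> mult_chars. R \<odot> R = A}.
             hyp_F \<theta> [R \<odot> char_inv B, C, D] [R, A \<odot> char_inv B] 1) +
        of_nat CARD('a) * (of_nat CARD('a) - 1) * char_delta (char_inv A \<odot> C \<odot> D) /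
          (gauss_sum \<theta> C * gauss_sum \<theta> (char_inv C) *
           gauss_sum \<theta> (A \<odot> char_inv C) * gauss_sum \<theta> (char_inv A \<odot> C)) *
          hyp_F \<theta> [A, B] [A \<odot> char_inv B] (- 1)"
      unfolding ev_eqs sum_square_roots_ev
      unfolding ev_minus_char[symmetric]
      unfolding ev_uminus_char[symmetric] ev_plus_char[symmetric] char_delta_ev
      using neg_one_neq_one_if_odd_card[OF hyps(1)] by (intro well_poised_square)
  qed
qed

end
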